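(* Let $g_1,g_2:[0,1]\to\mathbb{R}$ be absolutely continuous, not identically zero, with $g_k(0)=g_k(1)=0$ and with essentially bounded a.e. derivatives $\phi_k=g_k'\in L^\infty([0,1])$, $k\in\{1,2\}$. For $k\in\{1,2\}$ set $$\Lambda_k=\frac{1}{\operatorname{ess\,sup}_{u\in[0,1]}\phi_k(u)}\in(0,\infty),\qquad \lambda_k=\frac{1}{\operatorname{ess\,inf}_{u\in[0,1]}\phi_k(u)}\in(-\infty,0),\qquad \pi_k=\frac{\Lambda_k}{\Lambda_k-\lambda_k}\in(0,1).$$ Define cdfs on $[0,1]$ by $$F_{U,[0]}(u)=u-\Lambda_1g_1(u),\quad F_{U,[1]}(u)=u-\lambda_1g_1(u),\quad F_{V,[0]}(v)=v-\Lambda_2g_2(v),\quad F_{V,[1]}(v)=v-\lambda_2g_2(v).$$ Let $U_{[0]},U_{[1]},V_{[0]},V_{[1]}$ be mutually independent random variables with $U_{[i]}\sim F_{U,[i]}$ and $V_{[i]}\sim F_{V,[i]}$ for $i\in\{0,1\}$. Let $(I_1,I_2)$ be a $\{0,1\}^2$-valued random vector, independent of $(U_{[0]},U_{[1]},V_{[0]},V_{[1]})$, with $\mathbb{P}(I_1=1)=\pi_1$ and $\mathbb{P}(I_2=1)=\pi_2$, and let $$\theta=\mathbb{E}\left[\frac{(I_1-\pi_1)(I_2-\pi_2)}{\pi_1\pi_2}\right].$$ Define $$U_1=(1-I_1)U_{[0]}+I_1U_{[1]},\qquad U_2=(1-I_2)V_{[0]}+I_2V_{[1]}.$$ Then: 1.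 $U_1$ and $U_2$ are each uniformly distributed on $(0,1)$. 2. The copula $C$ of $(U_1,U_2)$ satisfies $C(u_1,u_2)=u_1u_2+a\,g_1(u_1)g_2(u_2)$ for all $(u_1,u_2)\in[0,1]^2$, with $a=\Lambda_1\Lambda_2\theta$.
   Context: A copula on $[0,1]^2$ is a bivariate distribution function with uniform univariate margins on $[0,1]$; the copula of a random vector with uniform $(0,1)$ margins is its joint cdf restricted to $[0,1]^2$. The law of $(I_1,I_2)$ is determined by $\pi_1,\pi_2,\theta$: $\mathbb{P}(I_1=1,I_2=1)=\pi_1\pi_2(1+\theta)$, $\mathbb{P}(I_1=1,I_2=0)=\pi_1(1-\pi_2)-\pi_1\pi_2\theta$, $\mathbb{P}(I_1=0,I_2=1)=(1-\pi_1)\pi_2-\pi_1\pi_2\theta$, $\mathbb{P}(I_1=0,I_2=0)=(1-\pi_1)(1-\pi_2)+\pi_1\pi_2\theta$; $\theta$ is any value for which these are nonnegative. *)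

theory Defs
  imports "HOL-Probability.Probability"
begin

definition absolutely_continuous_on :: "real \<Rightarrow> real \<Rightarrow> (real \<Rightarrow> real) \<Rightarrow> bool" where
  "absolutely_continuous_on a b g \<longleftrightarrow>
     (\<forall>\<epsilon>>0. \<exists>\<delta>>0. \<forall>D :: (real \<times> real) set.
        finite D \<and> (\<forall>(s, t)\<in>D. a \<le> s \<and> s < t \<and> t \<le> b) \<and>
        disjoint_family_on (\<lambda>(s, t). {s<..<t}) D \<and>
        (\<Sum>(s, t)\<in>D. t - s) < \<delta>
        \<longrightarrow> (\<Sum>(s, t)\<in>D. \<bar>g t - g s\<bar>) < \<epsilon>)"

definition L_infty :: "'a measure \<Rightarrow> ('a \<Rightarrow> real) set" where
  "L_infty M = {f \<in> borel_measurable M. esssup M (\<lambda>x. ereal \<bar>f x\<bar>) < \<infinity>}"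

definition essinf :: "'a measure \<Rightarrow> ('a \<Rightarrow> ereal) \<Rightarrow> ereal" where
  "essinf M f = - esssup M (\<lambda>x. - f x)"

definition Lambda_upper :: "(real \<Rightarrow> real) \<Rightarrow> real" where
  "Lambda_upper \<phi> = 1 / real_of_ereal (esssup (lebesgue_on {0..1}) (\<lambda>u. ereal (\<phi> u)))"

definition lambda_lower :: "(real \<Rightarrow> real) \<Rightarrow> real" where
  "lambda_lower \<phi> = 1 / real_of_ereal (essinf (lebesgue_on {0..1}) (\<lambda>u. ereal (\<phi> u)))"

definition mix_prob :: "(real \<Rightarrow> real) \<Rightarrow> real" where
  "mix_prob \<phi> = Lambda_upper \<phi> / (Lambda_upper \<phi> - lambda_lower \<phi>)"

(* The function u - c g(u) on [0,1], extended to the whole line in the only way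
   compatible with its being the cdf of a law on [0,1]. *)
definition perturbed_cdf :: "real \<Rightarrow> (real \<Rightarrow> real) \<Rightarrow> real \<Rightarrow> real" where
  "perturbed_cdf c g u = (if u < 0 then 0 else if u \<le> 1 then u - c * g u else 1)"

definition component_cdf :: "(real \<Rightarrow> real) \<Rightarrow> (real \<Rightarrow> real) \<Rightarrow> nat \<Rightarrow> real \<Rightarrow> real" where
  "component_cdf g \<phi> i =
     perturbed_cdf (if i = 0 then Lambda_upper \<phi> else lambda_lower \<phi>) g"

definition is_cdf :: "(real \<Rightarrow> real) \<Rightarrow> bool" where
  "is_cdf F \<longleftrightarrow> (\<exists>\<mu>. real_distribution \<mu> \<and> cdf \<mu> = F)"

(* The library's indep_var requires both random variables to have values in the same type. *)
definition indep_pair ::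
  "'a measure \<Rightarrow> 'b measure \<Rightarrow> ('a \<Rightarrow> 'b) \<Rightarrow> 'c measure \<Rightarrow> ('a \<Rightarrow> 'c) \<Rightarrow> bool" where
  "indep_pair M N X K Y \<longleftrightarrow> X \<in> measurable M N \<and> Y \<in> measurable M K \<and>
     prob_space.indep_set M {X -` A \<inter> space M | A. A \<in> sets N}
                            {Y -` B \<inter> space M | B. B \<in> sets K}"

(* Meant for X and Y uniformly distributed on (0,1): the copula of (X, Y) is then the
   joint cdf itself, restricted to the unit square. *)
definition copula_of :: "'a measure \<Rightarrow> ('a \<Rightarrow> real) \<Rightarrow> ('a \<Rightarrow> real) \<Rightarrow> real \<times> real \<Rightarrow> real" where
  "copula_of M X Y =
     restrict (\<lambda>(x, y). measure M {\<omega> \<in> space M. X \<omega> \<le> x \<and> Y \<omega> \<le> y}) ({0..1} \<times> {0..1})"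

end

theory Submission
  imports Defs
begin

text \<open>
  Since an absolutely continuous function whose derivative is a.e. at most c has increments at
  most c times the increment of the argument, u - \<Lambda>g(u) and u - \<lambda>g(u) are nondecreasing, hence
  cdfs; and g would be monotone, hence zero, if \<phi> did not take both signs. The random factor
  \<Lambda> or \<lambda> selected by I equals -\<Lambda>(I - \<pi>)/\<pi>, which has mean zero. Conditioning on (I_1, I_2)
  therefore makes each margin uniform, and in the joint cdf leaves u_1 u_2 plus g_1(u_1) g_2(u_2)
  times the expected product of the two factors, which is \<Lambda>_1 \<Lambda>_2 \<theta>.
\<close>

section \<open>Absolute continuity, and increments bounded through the a.e. derivative\<close>

lemma absolutely_continuous_on_uminus:
  "absolutely_continuous_on a b (\<lambda>x. - f x) \<longleftrightarrow> absolutely_continuous_on a b f"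
  unfolding absolutely_continuous_on_def by (simp add: abs_minus_commute)

text \<open>Families \<open>D\<close> consisting of a single interval are enough: for them the
  definition is uniform continuity.\<close>

lemma absolutely_continuous_on_imp_continuous_on:
  assumes "absolutely_continuous_on a b f"
  shows "continuous_on {a..b} f"
  unfolding continuous_on_iff
proof (intro ballI allI impI)
  fix x e :: real assume x: "x \<in> {a..b}" and "0 < e"
  then obtain d where "d > 0" and d: "\<And>D :: (real \<times> real) set.
        finite D \<Longrightarrow> \<forall>(s, t)\<in>D. a \<le> s \<and> s < t \<and> t \<le> b \<Longrightarrow>
        disjoint_family_on (\<lambda>(s, t). {s<..<t}) D \<Longrightarrow>
        (\<Sum>(s, t)\<in>D. t - s) < d \<Longrightarrow> (\<Sum>(s, t)\<in>D. \<bar>f t - f s\<bar>) < e"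
    using assms unfolding absolutely_continuous_on_def by meson
  have "dist (f y) (f x) < e" if "y \<in> {a..b}" "dist y x < d" for y
  proof (cases x y rule: linorder_cases)
    case less
    then show ?thesis
      using d[of "{(x, y)}"] x that by (auto simp: disjoint_family_on_def dist_real_def)
  next
    case greater
    then show ?thesis
      using d[of "{(y, x)}"] x that by (auto simp: disjoint_family_on_def dist_real_def)
  qed (use \<open>0 < e\<close> in simp)
  with \<open>d > 0\<close> show "\<exists>d>0. \<forall>x'\<in>{a..b}. dist x' x < d \<longrightarrow> dist (f x') (f x) < e"
    by blast
qed

text \<open>
  Cousin's lemma: in a sufficiently fine tagged division of [x, y], the intervals tagged
  outside the exceptional null set N are controlled by the derivative at the tag, while those
  tagged in N lie in an open set of small measure, so absolute continuity controls them.
\<close>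
lemma absolutely_continuous_on_increment_le:
  assumes ac: "absolutely_continuous_on a b g"
    and deriv: "AE u in lebesgue_on {a..b}. (g has_real_derivative \<phi> u) (at u within {a..b})"
    and bound: "AE u in lebesgue_on {a..b}. \<phi> u \<le> c"
    and xy: "a \<le> x" "x \<le> y" "y \<le> b"
  shows "g y - g x \<le> c * (y - x)"
proof (rule field_le_epsilon)
  fix e :: real assume "0 < e"
  \<comment> \<open>The error budget: \<open>\<epsilon> * (y - x)\<close> for the slack in the slope
    at good tags, and \<open>\<epsilon>\<close> twice for the intervals tagged in \<open>N\<close>,
    once for the variation of \<open>g\<close> and once for the linear term.\<close>
  define \<epsilon> where "\<epsilon> = e / (2 + (y - x))"
  have "0 < \<epsilon>"
    using \<open>0 < e\<close> xy by (simp add: \<epsilon>_def)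
  have e: "e = \<epsilon> * (2 + (y - x))"
    using xy by (simp add: \<epsilon>_def)
  have "AE u in lebesgue_on {a..b}. (g has_real_derivative \<phi> u) (at u within {a..b}) \<and> \<phi> u \<le> c"
    using deriv bound by eventually_elim auto
  then obtain N where "\<And>u. u \<in> space (lebesgue_on {a..b}) - N \<Longrightarrow>
      (g has_real_derivative \<phi> u) (at u within {a..b}) \<and> \<phi> u \<le> c"
    and N: "N \<in> null_sets (lebesgue_on {a..b})"
    by (rule AE_E3) blast
  then have N': "(g has_real_derivative \<phi> u) (at u within {a..b})" "\<phi> u \<le> c"
    if "u \<in> {a..b} - N" for u
    using that by simp_all
  have null: "N \<in> null_sets lebesgue"
    using N by (simp add: null_sets_restrict_space)
  obtain \<delta> where "\<delta> > 0" and \<delta>: "\<And>D :: (real \<times> real) set.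
        finite D \<Longrightarrow> \<forall>(s, t)\<in>D. a \<le> s \<and> s < t \<and> t \<le> b \<Longrightarrow>
        disjoint_family_on (\<lambda>(s, t). {s<..<t}) D \<Longrightarrow>
        (\<Sum>(s, t)\<in>D. t - s) < \<delta> \<Longrightarrow> (\<Sum>(s, t)\<in>D. \<bar>g t - g s\<bar>) < \<epsilon>"
    using ac \<open>0 < \<epsilon>\<close> unfolding absolutely_continuous_on_def by meson
  \<comment> \<open>\<open>C\<close> dominates \<open>- (c + \<epsilon>)\<close>, and the added 1
    makes it a legitimate divisor. Total length below \<open>\<delta>'\<close> then keeps both the
    variation of \<open>g\<close> and \<open>C\<close> times the length within
    \<open>\<epsilon>\<close>.\<close>
  define C where "C = \<bar>c + \<epsilon>\<bar> + 1"
  have "C > 0" by (simp add: C_def)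
  define \<delta>' where "\<delta>' = min \<delta> (\<epsilon> / C)"
  have "\<delta>' > 0"
    using \<open>\<delta> > 0\<close> \<open>\<epsilon> > 0\<close> \<open>C > 0\<close> by (simp add: \<delta>'_def)
  obtain T where T: "open T" "N \<subseteq> T" "emeasure lebesgue (T - N) < ennreal \<delta>'"
    by (rule sets_lebesgue_outer_open[OF null_setsD2[OF null] \<open>\<delta>' > 0\<close>]) (rule that)
  have T': "emeasure lebesgue T < ennreal \<delta>'"
    using T null by (simp add: emeasure_Diff_null_set)
  \<comment> \<open>The gauge: on \<open>N\<close> the ball stays inside \<open>T\<close>; at other
    points of \<open>[a, b]\<close> it is a radius of first-order approximation up to
    \<open>\<epsilon>\<close>; elsewhere, where no tag lies, it is arbitrary.\<close>
  have "\<exists>d>0. (u \<in> N \<longrightarrow> ball u d \<subseteq> T) \<and> (u \<in> {a..b} - N \<longrightarrow>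
    (\<forall>v\<in>{a..b}. \<bar>v - u\<bar> < d \<longrightarrow> \<bar>g v - g u - \<phi> u * (v - u)\<bar> \<le> \<epsilon> * \<bar>v - u\<bar>))" for u
  proof (cases "u \<in> N")
    case True
    then obtain d where "d > 0" "ball u d \<subseteq> T"
      using T openE by blast
    with True show ?thesis by auto
  next
    case False
    show ?thesis
    proof (cases "u \<in> {a..b}")
      case True
      then have "(g has_derivative (\<lambda>h. \<phi> u * h)) (at u within {a..b})"
        using N'[of u] False by (simp add: has_field_derivative_def)
      then show ?thesis
        using False \<open>\<epsilon> > 0\<close> unfolding has_derivative_within_alt by auto
    qed (use False in \<open>auto intro: exI[of _ 1]\<close>)
  qed
  then obtain d where d: "\<And>u. d u > 0" "\<And>u. u \<in> N \<Longrightarrow> ball u (d u) \<subseteq> T"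
    "\<And>u v. u \<in> {a..b} - N \<Longrightarrow> v \<in> {a..b} \<Longrightarrow> \<bar>v - u\<bar> < d u \<Longrightarrow>
       \<bar>g v - g u - \<phi> u * (v - u)\<bar> \<le> \<epsilon> * \<bar>v - u\<bar>"
    by metis
  obtain p where p: "p tagged_division_of {x..y}" "(\<lambda>u. ball u (d u)) fine p"
    using fine_division_exists_real[OF gauge_ball_dependent[of d]] d(1) by blast
  note pD = tagged_division_ofD[OF p(1)]
  have interval: "K = {Inf K..Sup K} \<and> x \<le> Inf K \<and> Inf K \<le> u \<and> u \<le> Sup K \<and> Sup K \<le> y \<and> K \<subseteq> ball u (d u)"
    if K: "(u, K) \<in> p" for u K
  proof -
    obtain s t where st: "K = {s..t}"
      using pD(4)[OF K] by auto
    with pD(2)[OF K] have "s \<le> u" "u \<le> t" by auto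
    then have "Inf K = s" "Sup K = t"
      by (auto simp: st)
    with st \<open>s \<le> u\<close> \<open>u \<le> t\<close> show ?thesis
      using pD(3)[OF K] p(2) K by (auto simp: fine_def)
  qed
  \<comment> \<open>The bad part of the division. Degenerate intervals are left out because absolute
    continuity speaks of \<open>s < t\<close> only; they add nothing to the telescoping sum.\<close>
  define P where "P = {(u, K) \<in> p. u \<in> N \<and> Inf K < Sup K}"
  have "finite P"
    using pD(1) by (rule finite_subset[rotated]) (auto simp: P_def)
  let ?I = "\<lambda>(u :: real, K :: real set). (Inf K, Sup K)"
  define D where "D = ?I ` P"
  \<comment> \<open>A common interior point identifies the intervals together with their tags. This
    gives disjointness of \<open>D\<close> and, with the midpoint as \<open>w\<close>, injectivity
    of forgetting the tag.\<close>
  have eqI: "q = r" if "q \<in> P" "r \<in> P" "w \<in> {Inf (snd q)<..<Sup (snd q)}" "w \<in> {Inf (snd r)<..<Sup (snd r)}"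
    for q r w
  proof (rule ccontr)
    assume "q \<noteq> r"
    moreover obtain u K v L where qr: "q = (u, K)" "r = (v, L)" by fastforce
    ultimately have "interior K \<inter> interior L = {}"
      using that pD(5)[of u K v L] by (auto simp: P_def)
    moreover have "K = {Inf K..Sup K}" "L = {Inf L..Sup L}"
      using that interval qr by (auto simp: P_def)
    then have "interior K = {Inf K<..<Sup K}" "interior L = {Inf L<..<Sup L}"
      by (metis interior_atLeastAtMost_real)+
    ultimately show False
      using that qr by auto
  qed
  have inj: "inj_on ?I P"
  proof (rule inj_onI)
    fix q r assume "q \<in> P" "r \<in> P" "?I q = ?I r"
    then show "q = r"
      using eqI[of q r "(Inf (snd q) + Sup (snd q)) / 2"]
      by (auto simp: P_def split: prod.splits)
  qed
  have sumD: "(\<Sum>(s, t)\<in>D. f s t) = (\<Sum>(u, K)\<in>P. f (Inf K) (Sup K))" for f :: "real \<Rightarrow> real \<Rightarrow> real"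
    unfolding D_def by (subst sum.reindex[OF inj]) (simp add: case_prod_unfold)
  have Dbounds: "\<forall>(s, t)\<in>D. a \<le> s \<and> s < t \<and> t \<le> b"
    using interval xy by (fastforce simp: D_def P_def)
  have disj: "disjoint_family_on (\<lambda>(s, t). {s<..<t}) D"
    unfolding disjoint_family_on_def
  proof (intro ballI impI, rule ccontr)
    fix m n assume "m \<in> D" "n \<in> D" "m \<noteq> n"
      and ne: "(case m of (s, t) \<Rightarrow> {s<..<t}) \<inter> (case n of (s, t) \<Rightarrow> {s<..<t}) \<noteq> {}"
    then obtain q r where qr: "q \<in> P" "r \<in> P" "m = ?I q" "n = ?I r"
      by (auto simp: D_def)
    from ne obtain w where "w \<in> (case m of (s, t) \<Rightarrow> {s<..<t})" "w \<in> (case n of (s, t) \<Rightarrow> {s<..<t})"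
      by blast
    with eqI[of q r w] qr \<open>m \<noteq> n\<close> show False
      by (auto simp: case_prod_unfold)
  qed
  \<comment> \<open>The intervals of \<open>D\<close> are disjoint and lie in balls around points of
    \<open>N\<close>, hence in \<open>T\<close>; so their total length is at most the measure of
    \<open>T\<close>.\<close>
  have "ennreal (\<Sum>(s, t)\<in>D. t - s) = (\<Sum>m\<in>D. emeasure lebesgue (case m of (s, t) \<Rightarrow> {s<..<t}))"
    using Dbounds by (subst sum_ennreal[symmetric]) (auto intro!: sum.cong)
  also have "\<dots> = emeasure lebesgue (\<Union>m\<in>D. case m of (s, t) \<Rightarrow> {s<..<t})"
    using \<open>finite P\<close> disj by (intro sum_emeasure) (auto simp: D_def)
  also have "\<dots> \<le> emeasure lebesgue T"
  proof (rule emeasure_mono)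
    show "(\<Union>m\<in>D. case m of (s, t) \<Rightarrow> {s<..<t}) \<subseteq> T"
    proof clarify
      fix w s t assume "(s, t) \<in> D" "w \<in> {s<..<t}"
      then obtain u K where "(u, K) \<in> p" "u \<in> N" "w \<in> {Inf K<..<Sup K}"
        by (auto simp: D_def P_def)
      with interval[of u K] d(2)[of u] show "w \<in> T"
        by (metis atLeastAtMost_iff greaterThanLessThan_iff less_imp_le subsetD)
    qed
  qed (use T in auto)
  also have "\<dots> < ennreal \<delta>'" by (rule T')
  finally have lenD: "(\<Sum>(s, t)\<in>D. t - s) < \<delta>'"
    by (metis ennreal_leI not_less)
  then have varD: "(\<Sum>(s, t)\<in>D. \<bar>g t - g s\<bar>) < \<epsilon>"
    using \<open>finite P\<close> disj Dbounds by (intro \<delta>) (auto simp: D_def \<delta>'_def)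
  \<comment> \<open>After subtracting the line of slope \<open>c + \<epsilon>\<close>, every
    interval outside \<open>P\<close> has a nonpositive increment, so the telescoping sum is bounded
    by its part over \<open>P\<close>.\<close>
  let ?h = "\<lambda>w. g w - (c + \<epsilon>) * w"
  have "?h y - ?h x = (\<Sum>(u, K)\<in>p. ?h (Sup K) - ?h (Inf K))"
    using additive_tagged_division_1[OF xy(2) p(1), of ?h] by simp
  also have "\<dots> \<le> (\<Sum>(u, K)\<in>P. ?h (Sup K) - ?h (Inf K))"
  proof -
    have "?h (Sup K) - ?h (Inf K) \<le> 0" if K: "(u, K) \<in> p - P" for u K
    proof (cases "Inf K < Sup K")
      case True
      with K have u: "u \<notin> N" by (auto simp: P_def)
      note iv = interval[of u K]
      have *: "Inf K \<in> {a..b}" "Sup K \<in> {a..b}" "u \<in> {a..b} - N"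
        using iv K u xy by auto
      have "Inf K \<in> K" "Sup K \<in> K" "K \<subseteq> ball u (d u)"
        using iv K by (metis DiffD1 atLeastAtMost_iff order.trans order_refl)+
      then have **: "\<bar>Inf K - u\<bar> < d u" "\<bar>Sup K - u\<bar> < d u"
        by (auto simp: dist_real_def abs_minus_commute)
      \<comment> \<open>The tag lies between the endpoints, so the two errors add up to
        \<open>\<epsilon>\<close> times exactly the length of \<open>K\<close>.\<close>
      have "\<bar>g (Sup K) - g u - \<phi> u * (Sup K - u)\<bar> \<le> \<epsilon> * (Sup K - u)"
        "\<bar>g (Inf K) - g u - \<phi> u * (Inf K - u)\<bar> \<le> \<epsilon> * (u - Inf K)"
        using d(3)[OF *(3,1) **(1)] d(3)[OF *(3,2) **(2)] iv K by auto
      then have "g (Sup K) - g (Inf K) \<le> (\<phi> u + \<epsilon>) * (Sup K - Inf K)"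
        by (simp add: algebra_simps abs_le_iff)
      also have "\<dots> \<le> (c + \<epsilon>) * (Sup K - Inf K)"
        using N'[OF *(3)] True by (intro mult_right_mono) auto
      finally show ?thesis by (simp add: algebra_simps)
    next
      case False
      with K interval[of u K] have "Inf K = Sup K" by auto
      then show ?thesis by simp
    qed
    then have "(\<Sum>(u, K)\<in>p - P. ?h (Sup K) - ?h (Inf K)) \<le> 0"
      by (intro sum_nonpos) auto
    moreover have "P \<subseteq> p" by (auto simp: P_def)
    ultimately show ?thesis
      by (simp add: sum.subset_diff[OF _ pD(1)])
  qed
  also have "\<dots> \<le> (\<Sum>(u, K)\<in>P. \<bar>g (Sup K) - g (Inf K)\<bar> + C * (Sup K - Inf K))"
  proof (rule sum_mono, clarify)
    fix u K assume "(u, K) \<in> P"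
    then have "Inf K < Sup K" by (auto simp: P_def)
    then have "- (c + \<epsilon>) * (Sup K - Inf K) \<le> C * (Sup K - Inf K)"
      by (intro mult_right_mono) (auto simp: C_def)
    then show "?h (Sup K) - ?h (Inf K) \<le> \<bar>g (Sup K) - g (Inf K)\<bar> + C * (Sup K - Inf K)"
      by (simp add: algebra_simps)
  qed
  also have "\<dots> = (\<Sum>(s, t)\<in>D. \<bar>g t - g s\<bar>) + C * (\<Sum>(s, t)\<in>D. t - s)"
    unfolding sumD by (simp add: sum.distrib sum_distrib_left case_prod_unfold)
  also have "\<dots> \<le> \<epsilon> + \<epsilon>"
  proof (rule add_mono)
    have "C * (\<Sum>(s, t)\<in>D. t - s) \<le> C * (\<epsilon> / C)"
      using lenD \<open>C > 0\<close> by (intro mult_left_mono) (auto simp: \<delta>'_def)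
    then show "C * (\<Sum>(s, t)\<in>D. t - s) \<le> \<epsilon>"
      using \<open>C > 0\<close> by simp
  qed (use varD in simp)
  finally show "g y - g x \<le> c * (y - x) + e"
    by (simp add: e algebra_simps)
qed

section \<open>Essential bounds of the derivative, and the constants \<Lambda> and \<lambda>\<close>

lemma L_infty_uminus:
  assumes "\<phi> \<in> L_infty M"
  shows "(\<lambda>x. - \<phi> x) \<in> L_infty M"
  using assms by (auto simp: L_infty_def)

text \<open>Reduces every fact about the lower constant to the upper one, applied to
  \<open>- g\<close> and \<open>- \<phi>\<close>.\<close>

lemma lambda_lower_eq: "lambda_lower \<phi> = - Lambda_upper (\<lambda>u. - \<phi> u)"
  by (simp add: lambda_lower_def Lambda_upper_def essinf_def)

text \<open>The bound on \<open>\<bar>\<phi>\<bar>\<close> excludes the value \<infinity>, and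
  -\<infinity> would make \<open>False\<close> hold a.e. on a space of nonzero measure. Hence
  \<open>real_of_ereal\<close> in \<open>Lambda_upper\<close> never returns its default for infinite
  arguments.\<close>

lemma L_infty_esssup_eq_ereal:
  assumes \<phi>: "\<phi> \<in> L_infty M" and M: "emeasure M (space M) \<noteq> 0"
  obtains S where "esssup M (\<lambda>x. ereal (\<phi> x)) = ereal S" "AE x in M. \<phi> x \<le> S"
proof (cases "esssup M (\<lambda>x. ereal (\<phi> x))")
  case (real S)
  moreover have "AE x in M. \<phi> x \<le> S"
    using esssup_AE[of "\<lambda>x. ereal (\<phi> x)" M] by (simp add: real)
  ultimately show ?thesis by (rule that)
next
  case PInf
  have "esssup M (\<lambda>x. ereal (\<phi> x)) \<le> esssup M (\<lambda>x. ereal \<bar>\<phi> x\<bar>)"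
    using \<phi> by (intro esssup_mono) (auto simp: L_infty_def)
  with PInf \<phi> show ?thesis
    by (auto simp: L_infty_def)
next
  case MInf
  then have "AE x in M. False"
    using esssup_AE[of "\<lambda>x. ereal (\<phi> x)" M] by simp
  with M show ?thesis
    by (simp add: AE_iff_measurable[OF _ refl])
qed

context
  fixes g \<phi> :: "real \<Rightarrow> real"
  assumes ac: "absolutely_continuous_on 0 1 g"
    and ne: "\<exists>u\<in>{0..1}. g u \<noteq> 0"
    and ends: "g 0 = 0" "g 1 = 0"
    and bdd: "\<phi> \<in> L_infty (lebesgue_on {0..1})"
    and deriv: "AE u in lebesgue_on {0..1}. (g has_real_derivative \<phi> u) (at u within {0..1})"
begin

text \<open>Once the essential supremum \<open>S\<close> is positive, dividing the increment bound
  of slope \<open>S\<close> by it makes \<open>u - \<Lambda> * g u\<close> nondecreasing on the unit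
  interval.\<close>

lemma Lambda_upper_pos: "Lambda_upper \<phi> > 0"
  and Lambda_upper_increment_le:
    "\<lbrakk>0 \<le> x; x \<le> y; y \<le> 1\<rbrakk> \<Longrightarrow> Lambda_upper \<phi> * (g y - g x) \<le> y - x"
proof -
  obtain S where S: "esssup (lebesgue_on {0..1}) (\<lambda>u. ereal (\<phi> u)) = ereal S"
      "AE u in lebesgue_on {0..1}. \<phi> u \<le> S"
    using L_infty_esssup_eq_ereal[OF bdd] by (auto simp: emeasure_restrict_space)
  have incr: "g y - g x \<le> S * (y - x)" if "0 \<le> x" "x \<le> y" "y \<le> 1" for x y
    using absolutely_continuous_on_increment_le[OF ac deriv S(2) that] .
  have "S > 0"
  proof (rule ccontr)
    assume "\<not> S > 0"
    obtain u where u: "0 \<le> u" "u \<le> 1" "g u \<noteq> 0"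
      using ne by auto
    \<comment> \<open>The increment from 0 to \<open>u\<close> gives \<open>g u \<le> 0\<close>, and
      the one from \<open>u\<close> to 1 gives \<open>g u \<ge> 0\<close>.\<close>
    have "S * u \<le> 0" "S * (1 - u) \<le> 0"
      using \<open>\<not> S > 0\<close> u by (auto simp: mult_nonpos_nonneg)
    then show False
      using incr[of 0 u] incr[of u 1] u ends by simp
  qed
  have \<Lambda>: "Lambda_upper \<phi> = 1 / S"
    by (simp add: Lambda_upper_def S)
  show "Lambda_upper \<phi> > 0"
    using \<Lambda> \<open>S > 0\<close> by simp
  show "Lambda_upper \<phi> * (g y - g x) \<le> y - x" if "0 \<le> x" "x \<le> y" "y \<le> 1"
    using incr[OF that] \<open>S > 0\<close> by (simp add: \<Lambda> field_simps)
qed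

end

section \<open>Perturbed and uniform cdfs on the unit interval\<close>

text \<open>Since \<open>g\<close> vanishes at both ends, clamping the argument to
  \<open>[0, 1]\<close> reproduces the constant tails; continuity and monotonicity on the line are
  then inherited from \<open>[0, 1]\<close>.\<close>

lemma perturbed_cdf_eq_clamp:
  assumes "g 0 = 0" "g 1 = 0"
  shows "perturbed_cdf c g = (\<lambda>u. max 0 (min 1 u) - c * g (max 0 (min 1 u)))"
  using assms by (auto simp: perturbed_cdf_def fun_eq_iff max_def min_def)

lemma is_cdf_perturbed_cdf:
  assumes cont: "continuous_on {0..1} g" and ends: "g 0 = 0" "g 1 = 0"
    and incr: "\<And>x y. \<lbrakk>0 \<le> x; x \<le> y; y \<le> 1\<rbrakk> \<Longrightarrow> c * (g y - g x) \<le> y - x"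
  shows "is_cdf (perturbed_cdf c g)"
proof -
  let ?F = "perturbed_cdf c g"
  have mono: "?F x \<le> ?F y" if "x \<le> y" for x y
    using incr[of "max 0 (min 1 x)" "max 0 (min 1 y)"] that
    by (simp add: perturbed_cdf_eq_clamp[OF ends] algebra_simps)
  have "continuous_on UNIV ?F"
    unfolding perturbed_cdf_eq_clamp[OF ends]
    by (intro continuous_intros continuous_on_compose2[OF cont]) auto
  then have cont_right: "continuous (at_right a) ?F" for a
    by (simp add: continuous_on_eq_continuous_at continuous_at_imp_continuous_at_within)
  have bot: "(?F \<longlongrightarrow> 0) at_bot"
    by (rule tendsto_eventually)
       (auto simp: perturbed_cdf_def eventually_at_bot_linorder intro!: exI[of _ "-1"])
  have top: "(?F \<longlongrightarrow> 1) at_top"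
    by (rule tendsto_eventually)
       (auto simp: perturbed_cdf_def eventually_at_top_linorder intro!: exI[of _ 2])
  \<comment> \<open>The required law is the Lebesgue-Stieltjes measure of \<open>?F\<close>.\<close>
  show ?thesis
    unfolding is_cdf_def
    using real_distribution_interval_measure[OF mono cont_right bot top]
      cdf_interval_measure[OF mono cont_right bot] by blast
qed

lemma cdf_uniform_measure_01:
  "cdf (uniform_measure lborel {0<..<1}) x = max 0 (min 1 x)"
proof -
  have "{0<..<1} \<inter> {..x} = (if x < 1 then {0<..x} else {0<..<1::real})"
    by auto
  then show ?thesis
    by (cases "0 \<le> x") (auto simp: cdf_def measure_def emeasure_uniform_measure divide_ennreal_def)
qed

lemma real_distribution_uniform_measure_01:
  "real_distribution (uniform_measure lborel {0<..<1})"
proof -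
  interpret prob_space "uniform_measure lborel {0<..<1::real}"
    by (rule prob_space_uniform_measure) auto
  show ?thesis
    by standard simp
qed

section \<open>Mixtures selected by a pair of 0-1 variables\<close>

context prob_space
begin

text \<open>Split by the value of the selectors: where they equal \<open>(i, j)\<close>, the
  mixtures are \<open>U i\<close> and \<open>V j\<close>. Arbitrary Borel sets are allowed so that
  \<open>UNIV\<close> yields the margins.\<close>

lemma prob_mixture_pair:
  fixes U V I :: "nat \<Rightarrow> 'a \<Rightarrow> real"
  assumes indep: "indep_vars (\<lambda>_. borel) (case_sum U V) ({0, 1} <+> {0, 1})"
    and I01: "\<forall>k\<in>{1, 2}. \<forall>\<omega>\<in>space M. I k \<omega> \<in> {0, 1}"
    and indepI: "indep_pair M
      (borel \<Otimes>\<^sub>M borel) (\<lambda>\<omega>. (I 1 \<omega>, I 2 \<omega>))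
      (borel \<Otimes>\<^sub>M borel \<Otimes>\<^sub>M borel \<Otimes>\<^sub>M borel) (\<lambda>\<omega>. (U 0 \<omega>, U 1 \<omega>, V 0 \<omega>, V 1 \<omega>))"
    and [measurable]: "A \<in> sets borel" "B \<in> sets borel"
  shows "prob {\<omega> \<in> space M. (1 - I 1 \<omega>) * U 0 \<omega> + I 1 \<omega> * U 1 \<omega> \<in> A \<and>
                             (1 - I 2 \<omega>) * V 0 \<omega> + I 2 \<omega> * V 1 \<omega> \<in> B} =
    (\<Sum>i\<in>{0, 1}. \<Sum>j\<in>{0, 1}. prob {\<omega> \<in> space M. I 1 \<omega> = real i \<and> I 2 \<omega> = real j} *
       (prob {\<omega> \<in> space M. U i \<omega> \<in> A} * prob {\<omega> \<in> space M. V j \<omega> \<in> B}))"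
proof -
  have rvU: "random_variable borel (U i)" if "i \<in> {0, 1}" for i
    using indep that unfolding indep_vars_def by (auto dest: bspec[of _ _ "Inl i"])
  have rvV: "random_variable borel (V i)" if "i \<in> {0, 1}" for i
    using indep that unfolding indep_vars_def by (auto dest: bspec[of _ _ "Inr i"])
  have "(\<lambda>\<omega>. (I 1 \<omega>, I 2 \<omega>)) \<in> measurable M (borel \<Otimes>\<^sub>M borel)"
    using indepI by (simp add: indep_pair_def)
  then have rvI[measurable]: "random_variable borel (I 1)" "random_variable borel (I 2)"
    by (auto simp: measurable_pair_iff o_def)
  have ind: "indep_set {(\<lambda>\<omega>. (I 1 \<omega>, I 2 \<omega>)) -` A \<inter> space M |A. A \<in> sets (borel \<Otimes>\<^sub>M borel)}
     {(\<lambda>\<omega>. (U 0 \<omega>, U 1 \<omega>, V 0 \<omega>, V 1 \<omega>)) -` B \<inter> space M |B.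
       B \<in> sets (borel \<Otimes>\<^sub>M borel \<Otimes>\<^sub>M borel \<Otimes>\<^sub>M borel)}"
    using indepI by (simp add: indep_pair_def)
  define E where "E = (\<lambda>(i, j). {\<omega> \<in> space M. I 1 \<omega> = real i \<and> I 2 \<omega> = real j \<and> U i \<omega> \<in> A \<and> V j \<omega> \<in> B})"
  have prob_E: "prob (E (i, j)) = prob {\<omega> \<in> space M. I 1 \<omega> = real i \<and> I 2 \<omega> = real j} *
       (prob {\<omega> \<in> space M. U i \<omega> \<in> A} * prob {\<omega> \<in> space M. V j \<omega> \<in> B})"
    if ij: "i \<in> {0, 1}" "j \<in> {0, 1}" for i j
  proof -
    let ?I = "{\<omega> \<in> space M. I 1 \<omega> = real i \<and> I 2 \<omega> = real j}"
    let ?W = "{\<omega> \<in> space M. U i \<omega> \<in> A \<and> V j \<omega> \<in> B}"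
    let ?A' = "{real i} \<times> {real j}"
    \<comment> \<open>Only the selected components are constrained; \<open>UNIV\<close> in the other
      coordinates presents \<open>?W\<close> as an event of the whole quadruple, as independence
      from the selectors requires.\<close>
    let ?B' = "(if i = 0 then A else UNIV) \<times> (if i = 0 then UNIV else A) \<times>
               (if j = 0 then B else UNIV) \<times> (if j = 0 then UNIV else B)"
    have "?I = (\<lambda>\<omega>. (I 1 \<omega>, I 2 \<omega>)) -` ?A' \<inter> space M"
      by auto
    moreover have "?A' \<in> sets (borel \<Otimes>\<^sub>M borel)"
      by (intro pair_measureI) auto
    moreover have "?W = (\<lambda>\<omega>. (U 0 \<omega>, U 1 \<omega>, V 0 \<omega>, V 1 \<omega>)) -` ?B' \<inter> space M"
      using ij by auto
    moreover have "?B' \<in> sets (borel \<Otimes>\<^sub>M borel \<Otimes>\<^sub>M borel \<Otimes>\<^sub>M borel)"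
      by (intro pair_measureI) auto
    ultimately have "prob (?I \<inter> ?W) = prob ?I * prob ?W"
      by (intro indep_setD[OF ind]) blast+
    moreover have "E (i, j) = ?I \<inter> ?W"
      by (auto simp: E_def)
    \<comment> \<open>Now the other independence, among the components themselves, separates
      \<open>U i\<close> from \<open>V j\<close>.\<close>
    moreover have "?W = (\<Inter>k\<in>{Inl i, Inr j}. case_sum U V k -` case_sum (\<lambda>_. A) (\<lambda>_. B) k \<inter> space M)"
      by auto
    moreover have "prob \<dots> =
      (\<Prod>k\<in>{Inl i, Inr j}. prob (case_sum U V k -` case_sum (\<lambda>_. A) (\<lambda>_. B) k \<inter> space M))"
      using ij by (intro indep_varsD[OF indep]) auto
    moreover have "\<dots> = prob {\<omega> \<in> space M. U i \<omega> \<in> A} * prob {\<omega> \<in> space M. V j \<omega> \<in> B}"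
      by (simp add: vimage_def Int_def conj_commute)
    ultimately show ?thesis by simp
  qed
  have "{\<omega> \<in> space M. (1 - I 1 \<omega>) * U 0 \<omega> + I 1 \<omega> * U 1 \<omega> \<in> A \<and>
                     (1 - I 2 \<omega>) * V 0 \<omega> + I 2 \<omega> * V 1 \<omega> \<in> B} = (\<Union>k\<in>{0, 1} \<times> {0, 1}. E k)"
    using I01 by (fastforce simp: E_def)
  also have "prob \<dots> = (\<Sum>k\<in>{0, 1} \<times> {0, 1}. prob (E k))"
  proof (rule finite_measure_finite_Union)
    have "E (i, j) \<in> events" if "i \<in> {0, 1}" "j \<in> {0, 1}" for i j
    proof -
      note [measurable] = rvU[OF that(1)] rvV[OF that(2)]
      show ?thesis
        unfolding E_def prod.case by measurable
    qed
    then show "E ` ({0, 1} \<times> {0, 1}) \<subseteq> events"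
      by blast
    show "disjoint_family_on E ({0, 1} \<times> {0, 1})"
      by (auto simp: E_def disjoint_family_on_def)
  qed auto
  also have "\<dots> = (\<Sum>i\<in>{0, 1}. \<Sum>j\<in>{0, 1}. prob (E (i, j)))"
    by (simp add: sum.cartesian_product)
  finally show ?thesis
    using prob_E by simp
qed

text \<open>For 0-1 values the product of the centred variables is an affine combination of three
  indicators, which is integrated term by term.\<close>

lemma expectation_bernoulli_pair:
  fixes X Y :: "'a \<Rightarrow> real"
  assumes [measurable]: "X \<in> borel_measurable M" "Y \<in> borel_measurable M"
    and X01: "\<And>\<omega>. \<omega> \<in> space M \<Longrightarrow> X \<omega> \<in> {0, 1}" and Y01: "\<And>\<omega>. \<omega> \<in> space M \<Longrightarrow> Y \<omega> \<in> {0, 1}"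
  shows "expectation (\<lambda>\<omega>. (X \<omega> - prob {\<omega> \<in> space M. X \<omega> = 1}) * (Y \<omega> - prob {\<omega> \<in> space M. Y \<omega> = 1})) =
    prob {\<omega> \<in> space M. X \<omega> = 1 \<and> Y \<omega> = 1} - prob {\<omega> \<in> space M. X \<omega> = 1} * prob {\<omega> \<in> space M. Y \<omega> = 1}"
    (is "?E = prob ?XY - prob ?X * prob ?Y")
proof -
  have "?E = expectation (\<lambda>\<omega>. indicator ?XY \<omega> - prob ?Y * indicator ?X \<omega> - prob ?X * indicator ?Y \<omega>
      + prob ?X * prob ?Y)"
  proof (rule Bochner_Integration.integral_cong[OF refl])
    fix \<omega> assume "\<omega> \<in> space M"
    with X01[OF this] Y01[OF this]
    show "(X \<omega> - prob ?X) * (Y \<omega> - prob ?Y) =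
      indicator ?XY \<omega> - prob ?Y * indicator ?X \<omega> - prob ?X * indicator ?Y \<omega> + prob ?X * prob ?Y"
      by (elim insertE emptyE) (simp_all add: algebra_simps)
  qed
  also have "\<dots> = prob ?XY - prob ?X * prob ?Y"
  proof -
    have const: "has_bochner_integral M (\<lambda>_. c) c" for c :: real
      by (simp add: has_bochner_integral_iff prob_space)
    have ind: "has_bochner_integral M (indicator A) (prob A)" if "A \<in> events" for A
      using that by (intro has_bochner_integral_real_indicator) (simp_all add: less_top[symmetric])
    have "has_bochner_integral M
        (\<lambda>\<omega>. indicator ?XY \<omega> - prob ?Y * indicator ?X \<omega> - prob ?X * indicator ?Y \<omega> + prob ?X * prob ?Y)
        (prob ?XY - prob ?Y * prob ?X - prob ?X * prob ?Y + prob ?X * prob ?Y)"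
      by (intro has_bochner_integral_add has_bochner_integral_diff has_bochner_integral_mult_right
          ind const) measurable
    from has_bochner_integral_integral_eq[OF this] show ?thesis
      by simp
  qed
  finally show ?thesis .
qed

text \<open>A two-by-two table of probabilities is determined by its margins and one entry: each row
  and column is a disjoint union of two cells.\<close>

lemma prob_bernoulli_pair:
  fixes X Y :: "'a \<Rightarrow> real"
  assumes [measurable]: "X \<in> borel_measurable M" "Y \<in> borel_measurable M"
    and X01: "\<And>\<omega>. \<omega> \<in> space M \<Longrightarrow> X \<omega> \<in> {0, 1}" and Y01: "\<And>\<omega>. \<omega> \<in> space M \<Longrightarrow> Y \<omega> \<in> {0, 1}"
  defines "p \<equiv> prob {\<omega> \<in> space M. X \<omega> = 1 \<and> Y \<omega> = 1}"
  shows "prob {\<omega> \<in> space M. X \<omega> = 1 \<and> Y \<omega> = 0} = prob {\<omega> \<in> space M. X \<omega> = 1} - p"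
    and "prob {\<omega> \<in> space M. X \<omega> = 0 \<and> Y \<omega> = 1} = prob {\<omega> \<in> space M. Y \<omega> = 1} - p"
    and "prob {\<omega> \<in> space M. X \<omega> = 0 \<and> Y \<omega> = 0} =
      1 - prob {\<omega> \<in> space M. X \<omega> = 1} - prob {\<omega> \<in> space M. Y \<omega> = 1} + p"
proof -
  have X: "prob {\<omega> \<in> space M. X \<omega> = 1} = p + prob {\<omega> \<in> space M. X \<omega> = 1 \<and> Y \<omega> = 0}"
    unfolding p_def using Y01
    by (subst finite_measure_Union[symmetric]) (auto intro!: arg_cong[where f=prob])
  have Y: "prob {\<omega> \<in> space M. Y \<omega> = 1} = p + prob {\<omega> \<in> space M. X \<omega> = 0 \<and> Y \<omega> = 1}"
    unfolding p_def using X01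
    by (subst finite_measure_Union[symmetric]) (auto intro!: arg_cong[where f=prob])
  have "1 - prob {\<omega> \<in> space M. X \<omega> = 1} = prob {\<omega> \<in> space M. X \<omega> = 0}"
    using X01 by (subst prob_compl[symmetric]) (auto intro!: arg_cong[where f=prob])
  also have "\<dots> = prob {\<omega> \<in> space M. X \<omega> = 0 \<and> Y \<omega> = 1} + prob {\<omega> \<in> space M. X \<omega> = 0 \<and> Y \<omega> = 0}"
    using Y01
    by (subst finite_measure_Union[symmetric]) (auto intro!: arg_cong[where f=prob])
  finally show "prob {\<omega> \<in> space M. X \<omega> = 1 \<and> Y \<omega> = 0} = prob {\<omega> \<in> space M. X \<omega> = 1} - p"
    "prob {\<omega> \<in> space M. X \<omega> = 0 \<and> Y \<omega> = 1} = prob {\<omega> \<in> space M. Y \<omega> = 1} - p"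
    "prob {\<omega> \<in> space M. X \<omega> = 0 \<and> Y \<omega> = 0} =
      1 - prob {\<omega> \<in> space M. X \<omega> = 1} - prob {\<omega> \<in> space M. Y \<omega> = 1} + p"
    using X Y by simp_all
qed

end

section \<open>Uniform margins and the copula of the mixture pair\<close>

theorem theorem1:
  fixes g \<phi> :: "nat \<Rightarrow> real \<Rightarrow> real"
  assumes "\<And>k. k \<in> {1, 2} \<Longrightarrow> absolutely_continuous_on 0 1 (g k)"
    and "\<And>k. k \<in> {1, 2} \<Longrightarrow> \<exists>u\<in>{0..1}. g k u \<noteq> 0"
    and "\<And>k. k \<in> {1, 2} \<Longrightarrow> g k 0 = 0 \<and> g k 1 = 0"
    and "\<And>k. k \<in> {1, 2} \<Longrightarrow> \<phi> k \<in> L_infty (lebesgue_on {0..1})"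
    and "\<And>k. k \<in> {1, 2} \<Longrightarrow>
           AE u in lebesgue_on {0..1}. (g k has_real_derivative \<phi> k u) (at u within {0..1})"
  shows
    "(\<forall>k\<in>{1, 2}. Lambda_upper (\<phi> k) > 0 \<and> lambda_lower (\<phi> k) < 0 \<and>
        0 < mix_prob (\<phi> k) \<and> mix_prob (\<phi> k) < 1 \<and>
        (\<forall>i\<in>{0, 1}. is_cdf (component_cdf (g k) (\<phi> k) i))) \<and>
     (\<forall>(M :: 'a measure) (U :: nat \<Rightarrow> 'a \<Rightarrow> real) (V :: nat \<Rightarrow> 'a \<Rightarrow> real) (I :: nat \<Rightarrow> 'a \<Rightarrow> real).
        prob_space M \<and>
        prob_space.indep_vars M (\<lambda>_. borel) (case_sum U V) ({0, 1} <+> {0, 1}) \<and>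
        (\<forall>i\<in>{0, 1}. cdf (distr M borel (U i)) = component_cdf (g 1) (\<phi> 1) i) \<and>
        (\<forall>i\<in>{0, 1}. cdf (distr M borel (V i)) = component_cdf (g 2) (\<phi> 2) i) \<and>
        (\<forall>k\<in>{1, 2}. \<forall>\<omega>\<in>space M. I k \<omega> \<in> {0, 1}) \<and>
        indep_pair M
          (borel \<Otimes>\<^sub>M borel) (\<lambda>\<omega>. (I 1 \<omega>, I 2 \<omega>))
          (borel \<Otimes>\<^sub>M borel \<Otimes>\<^sub>M borel \<Otimes>\<^sub>M borel) (\<lambda>\<omega>. (U 0 \<omega>, U 1 \<omega>, V 0 \<omega>, V 1 \<omega>)) \<and>
        (\<forall>k\<in>{1, 2}. measure M {\<omega> \<in> space M. I k \<omega> = 1} = mix_prob (\<phi> k))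
        \<longrightarrow>
        (let \<theta> = (LINT \<omega>|M. (I 1 \<omega> - mix_prob (\<phi> 1)) * (I 2 \<omega> - mix_prob (\<phi> 2))
                             / (mix_prob (\<phi> 1) * mix_prob (\<phi> 2)));
             U1 = (\<lambda>\<omega>. (1 - I 1 \<omega>) * U 0 \<omega> + I 1 \<omega> * U 1 \<omega>);
             U2 = (\<lambda>\<omega>. (1 - I 2 \<omega>) * V 0 \<omega> + I 2 \<omega> * V 1 \<omega>);
             a = Lambda_upper (\<phi> 1) * Lambda_upper (\<phi> 2) * \<theta>
         in distr M borel U1 = uniform_measure lborel {0<..<1} \<and>
            distr M borel U2 = uniform_measure lborel {0<..<1} \<and>
            (\<forall>u1\<in>{0..1}. \<forall>u2\<in>{0..1}.
               copula_of M U1 U2 (u1, u2) = u1 * u2 + a * g 1 u1 * g 2 u2)))"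
proof -
  let ?k = "{1, 2} :: nat set"
  have \<Lambda>: "Lambda_upper (\<phi> k) > 0" "lambda_lower (\<phi> k) < 0" and
    cdf: "\<And>i. is_cdf (component_cdf (g k) (\<phi> k) i)" if k: "k \<in> ?k" for k
  proof -
    note ac = assms(1)[OF k] and ne = assms(2)[OF k] and ends = assms(3)[OF k]
      and bdd = assms(4)[OF k] and deriv = assms(5)[OF k]
    have ac': "absolutely_continuous_on 0 1 (\<lambda>u. - g k u)"
      using ac by (simp add: absolutely_continuous_on_uminus)
    have deriv': "AE u in lebesgue_on {0..1}.
        ((\<lambda>u. - g k u) has_real_derivative - \<phi> k u) (at u within {0..1})"
      using deriv by eventually_elim (rule DERIV_minus)
    note upper = Lambda_upper_pos[OF ac ne _ _ bdd deriv]
      Lambda_upper_increment_le[OF ac ne _ _ bdd deriv]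
    \<comment> \<open>The same two facts for \<open>- g k\<close> and \<open>- \<phi> k\<close>; the
      two sign changes cancel in the increment bound for \<lambda>.\<close>
    note lower = Lambda_upper_pos[OF ac' _ _ _ L_infty_uminus[OF bdd] deriv']
      Lambda_upper_increment_le[OF ac' _ _ _ L_infty_uminus[OF bdd] deriv']
    show "Lambda_upper (\<phi> k) > 0" "lambda_lower (\<phi> k) < 0"
      using upper(1) lower(1) ne ends by (auto simp: lambda_lower_eq)
    note cont = absolutely_continuous_on_imp_continuous_on[OF ac]
    show "is_cdf (component_cdf (g k) (\<phi> k) i)" for i
    proof (cases "i = 0")
      case True
      then show ?thesis
        using is_cdf_perturbed_cdf[OF cont] upper(2) ends by (simp add: component_cdf_def)
    next
      case False
      have "lambda_lower (\<phi> k) * (g k y - g k x) \<le> y - x" if "0 \<le> x" "x \<le> y" "y \<le> 1" for x y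
        using lower(2)[OF _ _ _ that] ne ends by (simp add: lambda_lower_eq algebra_simps)
      then show ?thesis
        using is_cdf_perturbed_cdf[OF cont] ends False by (simp add: component_cdf_def)
    qed
  qed
  have mix: "0 < mix_prob (\<phi> k)" "mix_prob (\<phi> k) < 1" if "k \<in> ?k" for k
    using \<Lambda>[OF that] by (simp_all add: mix_prob_def field_simps)
  have mixture: "(1 - mix_prob (\<phi> k)) * component_cdf (g k) (\<phi> k) 0 x +
      mix_prob (\<phi> k) * component_cdf (g k) (\<phi> k) 1 x = max 0 (min 1 x)" if k: "k \<in> ?k" for k x
  proof -
    \<comment> \<open>This equation is what dictates the mixing probability: it cancels the terms
      with \<open>g k\<close> in the margin.\<close>
    have "(1 - mix_prob (\<phi> k)) * Lambda_upper (\<phi> k) + mix_prob (\<phi> k) * lambda_lower (\<phi> k) = 0"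
      using \<Lambda>[OF k] by (simp add: mix_prob_def field_simps)
    then have "(1 - mix_prob (\<phi> k)) * (x - Lambda_upper (\<phi> k) * g k x) +
        mix_prob (\<phi> k) * (x - lambda_lower (\<phi> k) * g k x) = x"
      by algebra
    then show ?thesis
      by (auto simp: component_cdf_def perturbed_cdf_def)
  qed
  show ?thesis
  proof (intro conjI allI impI ballI, goal_cases)
    \<comment> \<open>The five preceding cases are the signs of the constants, the bounds on the
      mixing probability and the cdf property; this one is the probabilistic claim.\<close>
    case (6 M U V I)
    then interpret prob_space M by blast
    note [simp del] = One_nat_def
    note indep = 6[THEN conjunct2, THEN conjunct1]
    have cdfU: "\<And>i. i \<in> {0, 1} \<Longrightarrow> cdf (distr M borel (U i)) = component_cdf (g 1) (\<phi> 1) i"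
      and cdfV: "\<And>i. i \<in> {0, 1} \<Longrightarrow> cdf (distr M borel (V i)) = component_cdf (g 2) (\<phi> 2) i"
      and I01: "\<forall>k\<in>{1, 2}. \<forall>\<omega>\<in>space M. I k \<omega> \<in> {0, 1}"
      and indepI: "indep_pair M
          (borel \<Otimes>\<^sub>M borel) (\<lambda>\<omega>. (I 1 \<omega>, I 2 \<omega>))
          (borel \<Otimes>\<^sub>M borel \<Otimes>\<^sub>M borel \<Otimes>\<^sub>M borel) (\<lambda>\<omega>. (U 0 \<omega>, U 1 \<omega>, V 0 \<omega>, V 1 \<omega>))"
      and probI: "prob {\<omega> \<in> space M. I 1 \<omega> = 1} = mix_prob (\<phi> 1)"
        "prob {\<omega> \<in> space M. I 2 \<omega> = 1} = mix_prob (\<phi> 2)"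
      using 6 by blast+
    define \<pi>1 \<pi>2 where "\<pi>1 = mix_prob (\<phi> 1)" and "\<pi>2 = mix_prob (\<phi> 2)"
    define F G where "F = component_cdf (g 1) (\<phi> 1)" and "G = component_cdf (g 2) (\<phi> 2)"
    define U1 U2 where "U1 = (\<lambda>\<omega>. (1 - I 1 \<omega>) * U 0 \<omega> + I 1 \<omega> * U 1 \<omega>)"
      and "U2 = (\<lambda>\<omega>. (1 - I 2 \<omega>) * V 0 \<omega> + I 2 \<omega> * V 1 \<omega>)"
    define \<theta> where "\<theta> = (LINT \<omega>|M. (I 1 \<omega> - \<pi>1) * (I 2 \<omega> - \<pi>2) / (\<pi>1 * \<pi>2))"
    have rv[measurable]: "random_variable borel (U 0)" "random_variable borel (U 1)"
      "random_variable borel (V 0)" "random_variable borel (V 1)"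
      "random_variable borel (I 1)" "random_variable borel (I 2)"
      using indepI by (auto simp: indep_pair_def measurable_pair_iff o_def)
    have [measurable]: "random_variable borel U1" "random_variable borel U2"
      unfolding U1_def U2_def by measurable
    have prob_le: "prob {\<omega> \<in> space M. X \<omega> \<in> {..x}} = cdf (distr M borel X) x"
      if [measurable]: "random_variable borel X" for X :: "'a \<Rightarrow> real" and x
      by (auto simp: cdf_def measure_distr intro!: arg_cong[where f=prob])
    have F: "prob {\<omega> \<in> space M. U i \<omega> \<in> {..x}} = F i x" if "i \<in> {0, 1}" for i x
      unfolding F_def cdfU[OF that, symmetric] using that rv by (intro prob_le) auto
    have G: "prob {\<omega> \<in> space M. V i \<omega> \<in> {..x}} = G i x" if "i \<in> {0, 1}" for i x
      unfolding G_def cdfV[OF that, symmetric] using that rv by (intro prob_le) auto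
    define p where "p = prob {\<omega> \<in> space M. I 1 \<omega> = 1 \<and> I 2 \<omega> = 1}"
    have p: "prob {\<omega> \<in> space M. I 1 \<omega> = 1 \<and> I 2 \<omega> = 0} = \<pi>1 - p"
        "prob {\<omega> \<in> space M. I 1 \<omega> = 0 \<and> I 2 \<omega> = 1} = \<pi>2 - p"
        "prob {\<omega> \<in> space M. I 1 \<omega> = 0 \<and> I 2 \<omega> = 0} = 1 - \<pi>1 - \<pi>2 + p"
      using prob_bernoulli_pair[of "I 1" "I 2"] I01 probI by (simp_all add: p_def \<pi>1_def \<pi>2_def)
    have pos: "\<pi>1 > 0" "\<pi>2 > 0"
      using mix by (simp_all add: \<pi>1_def \<pi>2_def)
    have "\<theta> = expectation (\<lambda>\<omega>. (I 1 \<omega> - \<pi>1) * (I 2 \<omega> - \<pi>2)) / (\<pi>1 * \<pi>2)"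
      by (simp add: \<theta>_def)
    also have "\<dots> = (p - \<pi>1 * \<pi>2) / (\<pi>1 * \<pi>2)"
      using expectation_bernoulli_pair[of "I 1" "I 2"] I01 probI by (simp add: p_def \<pi>1_def \<pi>2_def)
    \<comment> \<open>\<theta> is the covariance of the selectors divided by
      \<open>\<pi>1 * \<pi>2\<close>; solving for \<open>p\<close> expresses their joint law through
      \<theta>.\<close>
    finally have p_eq: "p = \<pi>1 * \<pi>2 * (1 + \<theta>)"
      using pos by (simp add: field_simps)
    have joint: "prob {\<omega> \<in> space M. U1 \<omega> \<in> A \<and> U2 \<omega> \<in> B} =
        (1 - \<pi>1 - \<pi>2 + p) * (prob {\<omega> \<in> space M. U 0 \<omega> \<in> A} * prob {\<omega> \<in> space M. V 0 \<omega> \<in> B}) +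
        (\<pi>2 - p) * (prob {\<omega> \<in> space M. U 0 \<omega> \<in> A} * prob {\<omega> \<in> space M. V 1 \<omega> \<in> B}) +
        (\<pi>1 - p) * (prob {\<omega> \<in> space M. U 1 \<omega> \<in> A} * prob {\<omega> \<in> space M. V 0 \<omega> \<in> B}) +
        p * (prob {\<omega> \<in> space M. U 1 \<omega> \<in> A} * prob {\<omega> \<in> space M. V 1 \<omega> \<in> B})"
      if "A \<in> sets borel" "B \<in> sets borel" for A B
      unfolding U1_def U2_def prob_mixture_pair[OF indep I01 indepI that]
      using p by (simp add: p_def)
    have unif1: "distr M borel U1 = uniform_measure lborel {0<..<1}"
    proof (rule cdf_unique)
      show "cdf (distr M borel U1) = cdf (uniform_measure lborel {0<..<1})"
      proof
        fix x
        have "cdf (distr M borel U1) x = prob {\<omega> \<in> space M. U1 \<omega> \<in> {..x} \<and> U2 \<omega> \<in> UNIV}"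
          by (simp add: prob_le[symmetric])
        \<comment> \<open>With \<open>UNIV\<close> for \<open>B\<close> the terms in
          \<open>p\<close> cancel, so the dependence between the selectors does not affect the
          margin.\<close>
        also have "\<dots> = (1 - \<pi>1) * F 0 x + \<pi>1 * F 1 x"
          using F[of 0 x] F[of 1 x] by (subst joint) (simp_all add: prob_space algebra_simps)
        finally show "cdf (distr M borel U1) x = cdf (uniform_measure lborel {0<..<1}) x"
          using mixture[of 1 x] by (simp add: cdf_uniform_measure_01 \<pi>1_def F_def)
      qed
    qed (simp_all add: real_distribution_distr real_distribution_uniform_measure_01)
    have unif2: "distr M borel U2 = uniform_measure lborel {0<..<1}"
    proof (rule cdf_unique)
      show "cdf (distr M borel U2) = cdf (uniform_measure lborel {0<..<1})"
      proof
        fix x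
        have "cdf (distr M borel U2) x = prob {\<omega> \<in> space M. U1 \<omega> \<in> UNIV \<and> U2 \<omega> \<in> {..x}}"
          by (simp add: prob_le[symmetric])
        also have "\<dots> = (1 - \<pi>2) * G 0 x + \<pi>2 * G 1 x"
          using G[of 0 x] G[of 1 x] by (subst joint) (simp_all add: prob_space algebra_simps)
        finally show "cdf (distr M borel U2) x = cdf (uniform_measure lborel {0<..<1}) x"
          using mixture[of 2 x] by (simp add: cdf_uniform_measure_01 \<pi>2_def G_def)
      qed
    qed (simp_all add: real_distribution_distr real_distribution_uniform_measure_01)
    have copula: "copula_of M U1 U2 (x, y) = x * y + Lambda_upper (\<phi> 1) * Lambda_upper (\<phi> 2) * \<theta> * g 1 x * g 2 y"
      if xy: "x \<in> {0..1}" "y \<in> {0..1}" for x y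
    proof -
      define L l K k where "L = Lambda_upper (\<phi> 1)" and "l = lambda_lower (\<phi> 1)"
        and "K = Lambda_upper (\<phi> 2)" and "k = lambda_lower (\<phi> 2)"
      \<comment> \<open>The definition of the mixing probability, cleared of its
        denominator.\<close>
      have l: "\<pi>1 * (L - l) = L" and k: "\<pi>2 * (K - k) = K"
        using \<Lambda>[of 1] \<Lambda>[of 2] by (simp_all add: \<pi>1_def \<pi>2_def mix_prob_def L_def l_def K_def k_def)
      have "copula_of M U1 U2 (x, y) = prob {\<omega> \<in> space M. U1 \<omega> \<in> {..x} \<and> U2 \<omega> \<in> {..y}}"
        using xy by (simp add: copula_of_def)
      also have "\<dots> = (1 - \<pi>1 - \<pi>2 + p) * ((x - L * g 1 x) * (y - K * g 2 y)) +
        (\<pi>2 - p) * ((x - L * g 1 x) * (y - k * g 2 y)) +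
        (\<pi>1 - p) * ((x - l * g 1 x) * (y - K * g 2 y)) +
        p * ((x - l * g 1 x) * (y - k * g 2 y))"
        using xy F[of 0 x] F[of 1 x] G[of 0 y] G[of 1 y]
        by (subst joint)
           (simp_all add: F_def G_def component_cdf_def perturbed_cdf_def L_def l_def K_def k_def)
      \<comment> \<open>Product of means plus covariance: \<open>L - \<pi>1 * (L - l)\<close> is the
        mean of the random factor and vanishes by \<open>l\<close>, likewise for the second margin
        by \<open>k\<close>; \<open>p - \<pi>1 * \<pi>2\<close> is the covariance of the
        selectors.\<close>
      also have "\<dots> = (x - (L - \<pi>1 * (L - l)) * g 1 x) * (y - (K - \<pi>2 * (K - k)) * g 2 y) +
          (p - \<pi>1 * \<pi>2) * (L - l) * (K - k) * g 1 x * g 2 y"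
        by (simp add: algebra_simps)
      \<comment> \<open>The covariance is \<open>\<pi>1 * \<pi>2 * \<theta>\<close>; grouping each
        probability with its gap leaves \<open>L * K * \<theta>\<close>, the coefficient
        \<open>a\<close>.\<close>
      also have "(p - \<pi>1 * \<pi>2) * (L - l) * (K - k) = (\<pi>1 * (L - l)) * (\<pi>2 * (K - k)) * \<theta>"
        unfolding p_eq by algebra
      finally show ?thesis
        unfolding l k by (simp add: L_def K_def)
    qed
    show ?case
      using unif1 unif2 copula
      unfolding U1_def U2_def \<theta>_def \<pi>1_def \<pi>2_def Let_def by blast
  qed (use \<Lambda> mix cdf in blast)+
qed

end
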